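(* For all $n\in\mathbb{N}$ and $k=1,\ldots,n$, and all $t\ge 0$, one has the identity $$\dot{\tau}_k^n(t)=-k\,\Lambda_k^n(t),$$ where $\tau_k^n$ are the de Branges functions and $\Lambda_k^n$ are the Weinstein functions. In particular, the inequalities $\dot\tau_k^n(t)\le 0$ and $\Lambda_k^n(t)\ge 0$ are equivalent.
   Context: $\mathbb{N}=\{1,2,3,\ldots\}$; a dot denotes the derivative with respect to $t$; $\mathbb{D}$ is the open unit disk in $\mathbb{C}$. De Branges functions: for fixed $n\in\mathbb{N}$, the functions $\tau_k^n:[0,\infty)\to\mathbb{R}$ $(k=1,\ldots,n+1)$ are the solution of the system of differential equations $$\tau_{k+1}^n(t)-\tau_k^n(t)=\frac{\dot\tau_k^n(t)}{k}+\frac{\dot\tau_{k+1}^n(t)}{k+1}\quad (k=1,\ldots,n),\qquad \tau_{n+1}^n\equiv 0,$$ with initial values $\tau_k^n(0)=n+1-k$. Weinstein functions: let $K(z)=\frac{z}{(1-z)^2}$ be the Koebe function, which is injective on $\mathbb{D}$, and for $z\in\mathbb{D}$, $t\ge 0$ let $w(z,t):=K^{-1}\big(e^{-t}K(z)\big)\in\mathbb{D}$ (i.e. $w(z,t)$ is the unique point of $\mathbb{D}$ with $K(w(z,t))=e^{-t}K(z)$). For $k\in\mathbb{N}$ the functions $\Lambda_k^n:[0,\infty)\to\mathbb{R}$ $(n\ge k)$ are defined as Taylor coefficients in $z$ by $$\frac{e^{t}\,w(z,t)^{k+1}}{1-w(z,t)^2}=\sum_{n=k}^{\infty}\Lambda_k^n(t)\,z^{n+1}\qquad(z\in\mathbb{D}).$$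 *)

theory Defs
  imports "HOL-Complex_Analysis.Complex_Analysis"
begin

text \<open>Derivative of a function on \<open>[0, \<infinity>)\<close>, one-sided at \<open>0\<close>.\<close>

definition dot :: "(real \<Rightarrow> real) \<Rightarrow> real \<Rightarrow> real" where
  "dot f t = vector_derivative f (at t within {0..})"

text \<open>Only the values \<open>\<tau> k t\<close> with \<open>k \<in> {1..n+1}\<close> and \<open>t \<ge> 0\<close> are constrained.\<close>

definition de_branges_functions :: "nat \<Rightarrow> (nat \<Rightarrow> real \<Rightarrow> real) \<Rightarrow> bool" where
  "de_branges_functions n \<tau> \<longleftrightarrow>
     (\<forall>k\<in>{1..n+1}. \<tau> k differentiable_on {0..}) \<and>
     (\<forall>k\<in>{1..n}. \<forall>t\<ge>0.
        \<tau> (k+1) t - \<tau> k t = dot (\<tau> k) t / real k + dot (\<tau> (k+1)) t / real (k+1)) \<and>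
     (\<forall>t\<ge>0. \<tau> (n+1) t = 0) \<and>
     (\<forall>k\<in>{1..n+1}. \<tau> k 0 = real n + 1 - real k)"

definition koebe :: "complex \<Rightarrow> complex" where
  "koebe z = z / (1 - z)^2"

definition koebe_flow :: "complex \<Rightarrow> real \<Rightarrow> complex" where
  "koebe_flow z t = inv_into (ball 0 1) koebe (of_real (exp (-t)) * koebe z)"

definition weinstein_gen :: "nat \<Rightarrow> real \<Rightarrow> complex \<Rightarrow> complex" where
  "weinstein_gen k t z =
     of_real (exp t) * koebe_flow z t ^ (k+1) / (1 - (koebe_flow z t)^2)"

text \<open>The Taylor coefficient is real, so taking the real part loses nothing; the lemma
  \<open>weinstein_gen_sums\<close> below gives the defining expansion with these real coefficients.\<close>

definition weinstein :: "nat \<Rightarrow> nat \<Rightarrow> real \<Rightarrow> real" where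
  "weinstein k n t = Re ((deriv ^^ (n+1)) (weinstein_gen k t) 0 / fact (n+1))"


subsection \<open>The flow is well defined and holomorphic\<close>

lemma inj_on_koebe: "inj_on koebe (ball 0 1)"
proof (rule inj_onI)
  fix z w :: complex
  assume z: "z \<in> ball 0 1" and w: "w \<in> ball 0 1" and eq: "koebe z = koebe w"
  have nz: "1 - z \<noteq> 0" "1 - w \<noteq> 0" using z w by auto
  have "z * (1 - w)^2 = w * (1 - z)^2"
    using eq nz by (simp add: koebe_def frac_eq_eq)
  hence "(z - w) * (1 - z * w) = 0" by algebra
  moreover have "norm (z * w) < 1"
    using z w by (simp add: norm_mult mult_strict_mono'[of "norm z" 1 "norm w" 1, simplified])
  hence "z * w \<noteq> 1" by auto
  ultimately show "z = w" by simp
qed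

lemma koebe_holomorphic: "koebe holomorphic_on ball 0 1"
  unfolding koebe_def by (intro holomorphic_intros) auto

lemma Joukowski_real_in_disc:
  fixes z :: complex
  assumes "norm z < 1" "z \<noteq> 0" "z + 1 / z = of_real s"
  shows "\<bar>s\<bar> > 2"
proof -
  have "z * z + 1 = of_real s * z" using assms by (simp add: field_simps)
  hence q: "z * (of_real s - z) = 1" by (simp add: algebra_simps)
  have pos: "(Re z)^2 + (Im z)^2 < 1"
    using assms(1) unfolding cmod_def by simp
  have im: "Im z * (s - 2 * Re z) = 0"
    using arg_cong[OF q, of Im] by (simp add: algebra_simps)
  have re: "Re z * (s - Re z) + (Im z)^2 = 1"
    using arg_cong[OF q, of Re] by (simp add: algebra_simps power2_eq_square)
  have "Im z = 0"
  proof (rule ccontr)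
    assume "Im z \<noteq> 0"
    hence "s = 2 * Re z" using im by simp
    thus False using re pos by (simp add: power2_eq_square)
  qed
  hence r: "Re z * s = 1 + (Re z)^2" and p: "(Re z)^2 < 1" 
    using re pos by (auto simp: algebra_simps power2_eq_square)
  have "\<bar>Re z\<bar> < 1" using p by (simp add: abs_square_less_1)
  moreover have "(1 - \<bar>Re z\<bar>)^2 > 0" using \<open>\<bar>Re z\<bar> < 1\<close> by simp
  hence "1 + (Re z)^2 > 2 * \<bar>Re z\<bar>" by (simp add: power2_eq_square algebra_simps)
  ultimately have "\<bar>Re z\<bar> * \<bar>s\<bar> > 2 * \<bar>Re z\<bar>"
    using r by (metis abs_ge_self abs_mult order_less_le_trans)
  hence "2 * \<bar>Re z\<bar> < \<bar>s\<bar> * \<bar>Re z\<bar>" by (simp add: mult.commute)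
  thus ?thesis by (rule mult_right_less_imp_less) simp
qed

lemma koebe_shrink_in_image:
  assumes z: "z \<in> ball 0 1" and t: "t \<ge> 0"
  shows "of_real (exp (-t)) * koebe z \<in> koebe ` ball 0 1"
proof (cases "z = 0")
  case True
  thus ?thesis by (auto simp: koebe_def intro!: image_eqI[of _ _ 0])
next
  case False
  define s where "s = of_real (exp t) * (z + 1 / z - 2) + 2"
  obtain w where w: "w^2 - s * w + 1 = 0"
  proof -
    have "((s + csqrt (s^2 - 4)) / 2)^2 - s * ((s + csqrt (s^2 - 4)) / 2) + 1
        = ((csqrt (s^2 - 4))^2 - (s^2 - 4)) / 4"
      by (simp add: field_simps power2_eq_square)
    also have "\<dots> = 0" by simp
    finally show ?thesis using that by blast
  qed
  have w0: "w \<noteq> 0" using w by auto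
  hence ws: "w + 1 / w = s" using w by (simp add: field_simps power2_eq_square)
  have "norm w \<noteq> 1"
  proof
    assume n1: "norm w = 1"
    have "1 / w = cnj w" using n1 by (simp add: divide_conv_cnj)
    hence s: "s = of_real (2 * Re w)" using ws by (simp add: complex_add_cnj)
    define a where "a = 2 + exp (-t) * (2 * Re w - 2)"
    have "z + 1 / z = 2 + of_real (exp (-t)) * (s - 2)"
      unfolding s_def by (simp add: algebra_simps flip: of_real_mult exp_add)
    hence "z + 1 / z = of_real a" unfolding a_def s by simp
    hence "\<bar>a\<bar> > 2" using Joukowski_real_in_disc z False by auto
    moreover have "\<bar>Re w\<bar> \<le> 1" using abs_Re_le_cmod[of w] n1 by simp
    moreover have "exp (-t) \<le> 1" "exp (-t) > 0" using t by auto
    hence "exp (-t) * (2 - 2 * Re w) \<le> 1 * (2 - 2 * Re w)"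
          "exp (-t) * (2 - 2 * Re w) \<ge> 0"
      using \<open>\<bar>Re w\<bar> \<le> 1\<close> by (intro mult_right_mono mult_nonneg_nonneg; simp)+
    ultimately show False unfolding a_def by (auto simp: algebra_simps abs_if split: if_splits)
  qed
  obtain v where v: "norm v < 1" "v \<noteq> 0" "v + 1 / v = s"
  proof (cases "norm w < 1")
    case True
    thus ?thesis using that w0 ws by blast
  next
    case False
    hence "norm w > 1" using \<open>norm w \<noteq> 1\<close> by simp
    hence "norm (1 / w) < 1" by (simp add: norm_divide divide_less_eq)
    thus ?thesis using that[of "1 / w"] w0 ws by (simp add: add.commute)
  qed
  have K: "koebe u = 1 / (u + 1 / u - 2)" if "norm u < 1" "u \<noteq> 0" for u
  proof -
    have "1 - u \<noteq> 0" using that by auto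
    have "u + 1 / u - 2 = (1 - u)^2 / u"
      using that by (simp add: field_simps power2_eq_square)
    thus ?thesis unfolding koebe_def by simp
  qed
  have "koebe v = of_real (exp (-t)) * koebe z"
    using K[of v] K[of z] v z False
    by (simp add: s_def exp_minus field_simps)
  thus ?thesis using v by (metis image_eqI mem_ball_0)
qed

lemma koebe_flow:
  assumes "z \<in> ball 0 1" "t \<ge> 0"
  shows "koebe_flow z t \<in> ball 0 1"
    and "koebe (koebe_flow z t) = of_real (exp (-t)) * koebe z"
  unfolding koebe_flow_def
  by (rule inv_into_into[OF koebe_shrink_in_image[OF assms]],
      rule f_inv_into_f[OF koebe_shrink_in_image[OF assms]])

lemma koebe_flow_unique:
  assumes "z \<in> ball 0 1" "t \<ge> 0" "w \<in> ball 0 1" "koebe w = of_real (exp (-t)) * koebe z"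
  shows "w = koebe_flow z t"
  using inj_onD[OF inj_on_koebe] koebe_flow[OF assms(1,2)] assms(3,4) by metis

lemma koebe_flow_0: "t \<ge> 0 \<Longrightarrow> koebe_flow 0 t = 0"
  using koebe_flow_unique[of 0 t 0] by (simp add: koebe_def)

lemma koebe_flow_holomorphic:
  assumes t: "t \<ge> 0"
  shows "(\<lambda>z. koebe_flow z t) holomorphic_on ball 0 1"
proof -
  obtain g where g: "g holomorphic_on koebe ` ball 0 1"
    "\<And>z. z \<in> ball 0 1 \<Longrightarrow> g (koebe z) = z"
    using holomorphic_has_inverse[OF koebe_holomorphic open_ball inj_on_koebe] by metis
  have "(g \<circ> (\<lambda>z. of_real (exp (-t)) * koebe z)) holomorphic_on ball 0 1"
    by (rule holomorphic_on_compose_gen[OF _ g(1)])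
       (use koebe_holomorphic koebe_shrink_in_image[OF _ t] in \<open>auto intro!: holomorphic_intros\<close>)
  moreover have "(g \<circ> (\<lambda>z. of_real (exp (-t)) * koebe z)) z = koebe_flow z t"
    if "z \<in> ball 0 1" for z
    using g(2) koebe_flow[OF that t] by (metis comp_apply)
  ultimately show ?thesis by (metis (no_types, lifting) holomorphic_transform)
qed

lemma koebe_flow_cnj:
  assumes "z \<in> ball 0 1" "t \<ge> 0"
  shows "koebe_flow (cnj z) t = cnj (koebe_flow z t)"
proof (rule koebe_flow_unique[symmetric])
  have K: "koebe (cnj u) = cnj (koebe u)" for u by (simp add: koebe_def)
  show "koebe (cnj (koebe_flow z t)) = of_real (exp (-t)) * koebe (cnj z)"
    using koebe_flow(2)[OF assms] by (simp add: K)
qed (use assms koebe_flow(1)[OF assms] in auto)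


subsection \<open>The defining expansion of the Weinstein functions\<close>

lemma weinstein_gen_holomorphic:
  assumes t: "t \<ge> 0"
  shows "weinstein_gen k t holomorphic_on ball 0 1"
proof -
  have "1 - (koebe_flow z t)^2 \<noteq> 0" if "z \<in> ball 0 1" for z
  proof
    assume "1 - (koebe_flow z t)^2 = 0"
    hence "norm (koebe_flow z t) ^ 2 = 1" by (simp flip: norm_power)
    moreover have "norm (koebe_flow z t) < 1" using koebe_flow(1)[OF that t] by simp
    hence "norm (koebe_flow z t) ^ 2 < 1" by (simp add: abs_square_less_1)
    ultimately show False by simp
  qed
  thus ?thesis unfolding weinstein_gen_def
    by (intro holomorphic_intros koebe_flow_holomorphic[OF t]) auto
qed

lemma weinstein_gen_sums_deriv:
  assumes "t \<ge> 0" "z \<in> ball 0 1"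
  shows "(\<lambda>m. (deriv ^^ m) (weinstein_gen k t) 0 / fact m * z ^ m) sums weinstein_gen k t z"
  using holomorphic_power_series[OF weinstein_gen_holomorphic[OF assms(1)] assms(2)] by simp

lemma weinstein_gen_coeff_real:
  assumes t: "t \<ge> 0"
  shows "(deriv ^^ m) (weinstein_gen k t) 0 / fact m \<in> \<real>"
proof -
  define a where "a m = (deriv ^^ m) (weinstein_gen k t) 0 / fact m" for m
  define A where "A = Abs_fps (\<lambda>m. cnj (a m))"
  have S: "(\<lambda>m. cnj (a m) * z ^ m) sums weinstein_gen k t z" if z: "z \<in> ball 0 1" for z
  proof -
    have "cnj z \<in> ball 0 1" using z by simp
    from weinstein_gen_sums_deriv[OF t this]
    have "(\<lambda>m. cnj (a m * cnj z ^ m)) sums cnj (weinstein_gen k t (cnj z))"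
      unfolding a_def sums_cnj .
    moreover have "cnj (weinstein_gen k t (cnj z)) = weinstein_gen k t z"
      by (simp add: weinstein_gen_def koebe_flow_cnj[OF z t])
    ultimately show ?thesis by simp
  qed
  have "summable (\<lambda>m. fps_nth A m * (1/2) ^ m)"
    using S[of "1/2"] by (auto simp: A_def norm_divide dest: sums_summable)
  hence "fps_conv_radius A \<ge> norm (1/2 :: complex)"
    unfolding fps_conv_radius_def by (rule conv_radius_geI)
  hence rad: "fps_conv_radius A > 0"
    by (rule less_le_trans[rotated]) (simp add: zero_ereal_def norm_divide)
  have "eventually (\<lambda>z. z \<in> ball 0 1) (nhds (0::complex))"
    by (intro eventually_nhds_in_open) auto
  hence "weinstein_gen k t has_fps_expansion A"
    unfolding has_fps_expansion_def using rad
    by (auto elim!: eventually_mono simp: eval_fps_def A_def intro!: sums_unique[symmetric] S[simplified])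
  from fps_nth_fps_expansion[OF this, of m] have "cnj (a m) = a m"
    by (simp add: A_def a_def)
  thus ?thesis by (simp add: a_def Reals_cnj_iff)
qed

lemma weinstein_gen_coeff_low:
  assumes t: "t \<ge> 0" and m: "m \<le> k"
  shows "(deriv ^^ m) (weinstein_gen k t) 0 = 0"
proof -
  define W where "W = fps_expansion (\<lambda>z. koebe_flow z t) 0"
  have W: "(\<lambda>z. koebe_flow z t) has_fps_expansion W"
    unfolding W_def
    by (rule has_fps_expansion_fps_expansion[OF _ _ koebe_flow_holomorphic[OF t]]) auto
  have W0: "fps_nth W 0 = 0" by (simp add: W_def fps_expansion_def koebe_flow_0[OF t])
  define H where "H = fps_const (of_real (exp t)) * W ^ (k+1) * inverse (1 - W^2)"
  have "(\<lambda>z. of_real (exp t) * koebe_flow z t ^ (k+1) * inverse (1 - (koebe_flow z t)^2))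
          has_fps_expansion H"
    unfolding H_def by (intro fps_expansion_intros W) (simp add: W0 power2_eq_square)
  hence "weinstein_gen k t has_fps_expansion H"
    unfolding weinstein_gen_def divide_inverse .
  hence "(deriv ^^ m) (weinstein_gen k t) 0 / fact m = fps_nth H m"
    by (simp add: fps_nth_fps_expansion)
  also have "fps_nth H m = 0"
  proof -
    have "fps_nth (fps_const (of_real (exp t)) * W ^ (k+1)) i = 0" if "i \<le> m" for i
      using startsby_zero_power_prefix[OF W0, of "k+1"] that m by (simp del: power_Suc)
    thus ?thesis unfolding H_def fps_mult_nth[of _ "inverse (1 - W^2)"]
      by (intro sum.neutral) (simp del: power_Suc)
  qed
  finally show ?thesis by simp
qed

theorem weinstein_gen_sums:
  assumes "t \<ge> 0" "z \<in> ball 0 1"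
  shows "(\<lambda>j. of_real (weinstein k (k+j) t) * z ^ (k+j+1)) sums weinstein_gen k t z"
proof -
  let ?a = "\<lambda>m. (deriv ^^ m) (weinstein_gen k t) 0 / fact m"
  have "(\<lambda>j. ?a (j + (k+1)) * z ^ (j + (k+1))) sums
          (weinstein_gen k t z - (\<Sum>m<k+1. ?a m * z ^ m))"
    using weinstein_gen_sums_deriv[OF assms] by (rule sums_split_initial_segment)
  moreover have "(\<Sum>m<k+1. ?a m * z ^ m) = 0"
    by (intro sum.neutral) (auto simp: weinstein_gen_coeff_low[OF assms(1)])
  moreover have "of_real (weinstein k (k+j) t) = ?a (j + (k+1))" for j
    using weinstein_gen_coeff_real[OF assms(1), of "k+j+1" k]
    by (simp add: weinstein_def of_real_Re add.commute add.left_commute)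
  ultimately show ?thesis by (simp add: add.commute add.left_commute)
qed


subsection \<open>Existence of the de Branges functions\<close>

lemma dot_eqI: "t \<ge> 0 \<Longrightarrow> (f has_real_derivative d) (at t within {0..}) \<Longrightarrow> dot f t = d"
  unfolding dot_def has_real_derivative_iff_has_vector_derivative
proof (rule vector_derivative_within)
  assume t: "t \<ge> 0"
  have "t islimpt {0..}"
    unfolding islimpt_approachable
  proof (intro allI impI)
    fix e :: real assume "e > 0"
    thus "\<exists>x\<in>{0..}. x \<noteq> t \<and> dist x t < e"
      using t by (intro bexI[of _ "t + e / 2"]) (auto simp: dist_real_def)
  qed
  thus "at t within {0..} \<noteq> bot" by (simp add: trivial_limit_within)
qed

lemma integral_has_real_derivative_Ici:
  fixes g :: "real \<Rightarrow> real"
  assumes g: "continuous_on {0..} g" and t: "t \<ge> 0"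
  shows "((\<lambda>x. integral {0..x} g) has_real_derivative g t) (at t within {0..})"
proof -
  have "((\<lambda>x. integral {0..x} g) has_real_derivative g t) (at t within {0..t+1})"
    using g t by (intro integral_has_real_derivative) (auto intro: continuous_on_subset)
  also have "at t within {0..t+1} = at t within {0..}"
    by (rule at_within_nhd[of _ "{..<t+1}"]) auto
  finally show ?thesis .
qed

lemma linear_ode_exists:
  fixes h :: "real \<Rightarrow> real"
  assumes h: "continuous_on {0..} h"
  obtains f where "f 0 = c"
    "\<And>t. t \<ge> 0 \<Longrightarrow> (f has_real_derivative h t - a * f t) (at t within {0..})"
proof (rule that[of "\<lambda>t. exp (- a * t) * (c + integral {0..t} (\<lambda>s. exp (a * s) * h s))"])
  let ?f = "\<lambda>t. exp (- a * t) * (c + integral {0..t} (\<lambda>s. exp (a * s) * h s))"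
  show "?f 0 = c" by simp
  fix t :: real assume t: "t \<ge> 0"
  define I where "I = (\<lambda>x. integral {0..x} (\<lambda>s. exp (a * s) * h s))"
  have "(I has_real_derivative exp (a * t) * h t) (at t within {0..})"
    unfolding I_def
    by (rule integral_has_real_derivative_Ici[OF _ t]) (intro continuous_intros h)
  hence "((\<lambda>t. exp (- a * t) * (c + I t)) has_real_derivative
           h t - a * (exp (- a * t) * (c + I t))) (at t within {0..})"
    by (auto intro!: derivative_eq_intros simp: exp_minus field_simps)
  thus "(?f has_real_derivative h t - a * ?f t) (at t within {0..})"
    by (simp only: I_def)
qed

theorem de_branges_functions_exist: "\<exists>\<tau>. de_branges_functions n \<tau>"
proof -
  have "\<exists>\<tau> \<tau>'. (\<forall>k\<in>{n+1-j..n+1}. continuous_on {0..} (\<tau>' k) \<and> \<tau> k 0 = real n + 1 - real k \<and>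
            (\<forall>t\<ge>0. (\<tau> k has_real_derivative \<tau>' k t) (at t within {0..}))) \<and>
          (\<forall>k\<in>{n+1-j..n}. \<forall>t\<ge>0. \<tau> (k+1) t - \<tau> k t = \<tau>' k t / real k + \<tau>' (k+1) t / real (k+1)) \<and>
          (\<forall>t\<ge>0. \<tau> (n+1) t = (0::real))" if "j \<le> n" for j
    using that
  proof (induction j)
    case 0
    show ?case by (intro exI[of _ "\<lambda>_ _. 0"]) auto
  next
    case (Suc j)
    then obtain \<tau> \<tau>' where
      A: "\<And>k. k \<in> {n+1-j..n+1} \<Longrightarrow> continuous_on {0..} (\<tau>' k) \<and> \<tau> k 0 = real n + 1 - real k \<and>
            (\<forall>t\<ge>0. (\<tau> k has_real_derivative \<tau>' k t) (at t within {0..}))" and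
      B: "\<And>k t. k \<in> {n+1-j..n} \<Longrightarrow> t \<ge> 0 \<Longrightarrow>
            \<tau> (k+1) t - \<tau> k t = \<tau>' k t / real k + \<tau>' (k+1) t / real (k+1)" and
      C: "\<And>t. t \<ge> 0 \<Longrightarrow> \<tau> (n+1) t = (0::real)"
      by (metis Suc_leD)
    define k where "k = n - j"
    have k: "k \<ge> 1" "k \<le> n" "k + 1 = n + 1 - j" "k = n + 1 - Suc j"
      using Suc.prems by (auto simp: k_def)
    define h where "h t = real k * (\<tau> (k+1) t - \<tau>' (k+1) t / real (k+1))" for t
    have D: "(\<tau> (k+1) has_real_derivative \<tau>' (k+1) t) (at t within {0..})" if "t \<ge> 0" for t
      using A[of "k+1"] k that by auto
    have "continuous_on {0..} (\<tau> (k+1))"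
      by (rule DERIV_continuous_on[where D = "\<tau>' (k+1)"]) (use D in auto)
    moreover have "continuous_on {0..} (\<tau>' (k+1))" using A[of "k+1"] k by auto
    ultimately have h: "continuous_on {0..} h"
      unfolding h_def by (intro continuous_intros) auto
    obtain f where f: "f 0 = real n + 1 - real k"
      "\<And>t. t \<ge> 0 \<Longrightarrow> (f has_real_derivative h t - real k * f t) (at t within {0..})"
      using linear_ode_exists[OF h] by blast
    have "continuous_on {0..} f"
      by (rule DERIV_continuous_on[where D = "\<lambda>t. h t - real k * f t"]) (use f(2) in auto)
    hence f': "continuous_on {0..} (\<lambda>t. h t - real k * f t)"
      by (intro continuous_intros h)
    define \<sigma> where "\<sigma> = \<tau>(k := f)"
    define \<sigma>' where "\<sigma>' = \<tau>'(k := \<lambda>t. h t - real k * f t)"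
    have "continuous_on {0..} (\<sigma>' i) \<and> \<sigma> i 0 = real n + 1 - real i \<and>
            (\<forall>t\<ge>0. (\<sigma> i has_real_derivative \<sigma>' i t) (at t within {0..}))"
      if "i \<in> {k..n+1}" for i
    proof (cases "i = k")
      case True
      thus ?thesis using f f' by (simp add: \<sigma>_def \<sigma>'_def)
    next
      case False
      hence "i \<in> {n+1-j..n+1}" using that k by auto
      thus ?thesis using A False by (simp add: \<sigma>_def \<sigma>'_def)
    qed
    moreover have "\<sigma> (i+1) t - \<sigma> i t = \<sigma>' i t / real i + \<sigma>' (i+1) t / real (i+1)"
      if "i \<in> {k..n}" "t \<ge> 0" for i t
    proof (cases "i = k")
      case True
      thus ?thesis using k(1) by (simp add: \<sigma>_def \<sigma>'_def h_def diff_divide_distrib)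
    next
      case False
      hence "i \<in> {n+1-j..n}" using that k by auto
      thus ?thesis using B[of i t] that False by (simp add: \<sigma>_def \<sigma>'_def)
    qed
    moreover have "\<sigma> (n+1) t = 0" if "t \<ge> 0" for t
      using C[OF that] k by (simp add: \<sigma>_def)
    ultimately show ?case unfolding k(4)[symmetric] by blast
  qed
  from this[of n] obtain \<tau> \<tau>' where
    "(\<forall>k\<in>{1..n+1}. continuous_on {0..} (\<tau>' k) \<and> \<tau> k 0 = real n + 1 - real k \<and>
            (\<forall>t\<ge>0. (\<tau> k has_real_derivative \<tau>' k t) (at t within {0..}))) \<and>
          (\<forall>k\<in>{1..n}. \<forall>t\<ge>0. \<tau> (k+1) t - \<tau> k t = \<tau>' k t / real k + \<tau>' (k+1) t / real (k+1)) \<and>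
          (\<forall>t\<ge>0. \<tau> (n+1) t = (0::real))"
    unfolding add_diff_cancel_left' by blast
  hence A: "\<And>k. k \<in> {1..n+1} \<Longrightarrow> \<tau> k 0 = real n + 1 - real k"
       "\<And>k t. k \<in> {1..n+1} \<Longrightarrow> t \<ge> 0 \<Longrightarrow> (\<tau> k has_real_derivative \<tau>' k t) (at t within {0..})"
    and B: "\<And>k t. k \<in> {1..n} \<Longrightarrow> t \<ge> 0 \<Longrightarrow>
          \<tau> (k+1) t - \<tau> k t = \<tau>' k t / real k + \<tau>' (k+1) t / real (k+1)"
    and C: "\<And>t. t \<ge> 0 \<Longrightarrow> \<tau> (n+1) t = (0::real)"
    by blast+
  have E: "dot (\<tau> k) t = \<tau>' k t" if "k \<in> {1..n+1}" "t \<ge> 0" for k t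
    by (rule dot_eqI[OF that(2) A(2)[OF that]])
  have "\<tau> k differentiable_on {0..}" if "k \<in> {1..n+1}" for k
    unfolding differentiable_on_def
    by (meson A(2)[OF that] atLeast_iff real_differentiable_def)
  moreover have "\<tau> (k+1) t - \<tau> k t = dot (\<tau> k) t / real k + dot (\<tau> (k+1)) t / real (k+1)"
    if "k \<in> {1..n}" "t \<ge> 0" for k t
    using B[OF that] E[of k t] E[of "k+1" t] that by simp
  ultimately show ?thesis
    unfolding de_branges_functions_def using A(1) C by blast
qed

end

theory Submission
  imports Defs
begin

text \<open>Since \<open>K(z) = e\<^sup>t K(w)\<close>, the functions \<open>K(z) w(z,t)\<^sup>k = e\<^sup>t K(w) w\<^sup>k\<close> have
  \<open>t\<close>-derivative \<open>- k e\<^sup>t w\<^sup>k\<^sup>+\<^sup>1 / (1 - w\<^sup>2)\<close>, satisfy the de Branges recursion in \<open>k\<close>, and equal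
  \<open>K(z) z\<^sup>k\<close> at \<open>t = 0\<close>; hence their coefficients at \<open>z\<^sup>n\<^sup>+\<^sup>1\<close> are the \<open>\<tau>\<close>-functions, by uniqueness
  for the linear system. If \<open>J\<close> is the
  compositional inverse of \<open>K\<close>, then \<open>w = J(e\<^sup>-\<^sup>t K(z))\<close>, so each Taylor coefficient of \<open>w\<^sup>k\<close>
  is a polynomial in \<open>e\<^sup>-\<^sup>t\<close> and differentiation in \<open>t\<close> becomes the operator
  \<open>-X d/dX\<close> applied before substituting \<open>e\<^sup>-\<^sup>t K\<close>.\<close>

section \<open>Formal series of the Koebe function and its inverse\<close>

definition koebe_fps :: "complex fps" where
  "koebe_fps = Abs_fps of_nat"

definition koebe_inv_fps :: "complex fps" where
  "koebe_inv_fps = fps_inv koebe_fps"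

lemma koebe_fps_nth [simp]: "fps_nth koebe_fps n = of_nat n"
  by (simp add: koebe_fps_def)

text \<open>Multiplying by (1 - X)^2 takes second differences of the coefficients, and those of n
  vanish except at index 1.\<close>

lemma koebe_fps_eq: "koebe_fps * (1 - fps_X)\<^sup>2 = fps_X"
proof (rule fps_ext)
  fix n
  have "koebe_fps * (1 - fps_X)\<^sup>2
      = koebe_fps - fps_X * koebe_fps - fps_X * koebe_fps + fps_X * (fps_X * koebe_fps)"
    by (simp add: power2_eq_square algebra_simps)
  then show "fps_nth (koebe_fps * (1 - fps_X)\<^sup>2) n = fps_nth fps_X n"
    by (cases n; cases "n - 1") auto
qed

lemma koebe_inv_fps_nth_0 [simp]: "fps_nth koebe_inv_fps 0 = 0"
  by (simp add: koebe_inv_fps_def fps_inv_def)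

lemma koebe_inv_fps_eq: "fps_X * (1 - koebe_inv_fps)\<^sup>2 = koebe_inv_fps"
proof -
  have "koebe_fps oo koebe_inv_fps = fps_X"
    unfolding koebe_inv_fps_def by (rule fps_inv_right) auto
  moreover have "(koebe_fps * (1 - fps_X)\<^sup>2) oo koebe_inv_fps = fps_X oo koebe_inv_fps"
    by (simp only: koebe_fps_eq)
  ultimately show ?thesis
    by (simp add: fps_compose_mult_distrib fps_compose_power[symmetric] fps_compose_sub_distrib)
qed

lemma koebe_inv_fps_deriv:
  "fps_X * fps_deriv koebe_inv_fps * (1 + koebe_inv_fps) = koebe_inv_fps * (1 - koebe_inv_fps)"
proof -
  let ?J = "koebe_inv_fps"
  have J: "fps_X * (1 - ?J)\<^sup>2 = ?J" by (rule koebe_inv_fps_eq)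
  have "fps_deriv (fps_X * (1 - ?J)\<^sup>2) = fps_deriv ?J" by (simp only: J)
  then have "(1 - ?J)\<^sup>2 - 2 * fps_X * (1 - ?J) * fps_deriv ?J = fps_deriv ?J"
    by (simp add: power2_eq_square algebra_simps)
  \<comment> \<open>The difference of the two sides is a combination of the equation for J and its
    derivative, so both summands vanish.\<close>
  moreover have "fps_X * fps_deriv ?J * (1 + ?J) - ?J * (1 - ?J)
      = fps_X * (1 - ?J) * (fps_deriv ?J - ((1 - ?J)\<^sup>2 - 2 * fps_X * (1 - ?J) * fps_deriv ?J))
      + (fps_X * (1 - ?J)\<^sup>2 - ?J) * ((1 - ?J) - 2 * fps_X * fps_deriv ?J)"
    by (simp add: power2_eq_square algebra_simps)
  ultimately show ?thesis using J by simp
qed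

text \<open>The analytic expansion W and the formal composition V solve the same equation F (1 -
  X)^2 = c X (1 - F)^2, which determines F.\<close>

lemma koebe_flow_fps_expansion:
  assumes t: "t \<ge> 0"
  shows "(\<lambda>z. koebe_flow z t) has_fps_expansion
           (koebe_inv_fps oo (fps_const (of_real (exp (-t))) * koebe_fps))"
proof -
  define W where "W = fps_expansion (\<lambda>z. koebe_flow z t) 0"
  define c where "c = (of_real (exp (-t)) :: complex)"
  define V where "V = koebe_inv_fps oo (fps_const c * koebe_fps)"
  have W: "(\<lambda>z. koebe_flow z t) has_fps_expansion W"
    unfolding W_def
    by (rule has_fps_expansion_fps_expansion[OF _ _ koebe_flow_holomorphic[OF t]]) auto
  have W0: "fps_nth W 0 = 0" by (simp add: W_def fps_expansion_def koebe_flow_0[OF t])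
  have V0: "fps_nth V 0 = 0" by (simp add: V_def)
  have flow: "koebe_flow z t * (1 - z)\<^sup>2 = c * z * (1 - koebe_flow z t)\<^sup>2" if "z \<in> ball 0 1" for z
  proof -
    have "1 - z \<noteq> 0" "1 - koebe_flow z t \<noteq> 0" using that koebe_flow(1)[OF that t] by auto
    with koebe_flow(2)[OF that t] show ?thesis
      by (simp add: koebe_def c_def frac_eq_eq)
  qed
  have "(\<lambda>z. koebe_flow z t * (1 - z)\<^sup>2) has_fps_expansion W * (1 - fps_X)\<^sup>2"
    by (intro fps_expansion_intros W)
  moreover have "(\<lambda>z. c * z * (1 - koebe_flow z t)\<^sup>2) has_fps_expansion
      fps_const c * fps_X * (1 - W)\<^sup>2"
    by (intro fps_expansion_intros W)
  moreover have "eventually (\<lambda>z. koebe_flow z t * (1 - z)\<^sup>2 = c * z * (1 - koebe_flow z t)\<^sup>2) (nhds 0)"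
    using eventually_nhds_in_open[of "ball 0 1" "0 :: complex"] flow
    by (auto elim!: eventually_mono)
  ultimately have "(\<lambda>z. koebe_flow z t * (1 - z)\<^sup>2) has_fps_expansion W * (1 - fps_X)\<^sup>2"
      "(\<lambda>z. koebe_flow z t * (1 - z)\<^sup>2) has_fps_expansion fps_const c * fps_X * (1 - W)\<^sup>2"
    by (simp_all cong: has_fps_expansion_cong)
  then have WE: "W * (1 - fps_X)\<^sup>2 = fps_const c * fps_X * (1 - W)\<^sup>2"
    by (rule fps_expansion_unique_complex)
  have "(fps_X * (1 - koebe_inv_fps)\<^sup>2) oo (fps_const c * koebe_fps) = V"
    by (simp only: koebe_inv_fps_eq V_def)
  then have "fps_const c * koebe_fps * (1 - V)\<^sup>2 = V"
    by (simp add: V_def fps_compose_mult_distrib fps_compose_power[symmetric] fps_compose_sub_distrib)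
  then have "V * (1 - fps_X)\<^sup>2 = fps_const c * koebe_fps * (1 - V)\<^sup>2 * (1 - fps_X)\<^sup>2"
    by (simp only:)
  also have "\<dots> = fps_const c * (koebe_fps * (1 - fps_X)\<^sup>2) * (1 - V)\<^sup>2"
    by (simp only: mult_ac)
  finally have VE: "V * (1 - fps_X)\<^sup>2 = fps_const c * fps_X * (1 - V)\<^sup>2"
    by (simp only: koebe_fps_eq)
  \<comment> \<open>Subtracting the equations splits off W - V; the cofactor has constant term 1,
    hence is nonzero in an integral domain.\<close>
  have "(W - V) * ((1 - fps_X)\<^sup>2 + fps_const c * fps_X * (2 - W - V)) = 0"
    using WE VE by algebra
  moreover have "fps_nth ((1 - fps_X)\<^sup>2 + fps_const c * fps_X * (2 - W - V)) 0 = 1"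
    by (simp add: power2_eq_square mult.assoc)
  then have "(1 - fps_X)\<^sup>2 + fps_const c * fps_X * (2 - W - V) \<noteq> 0"
    by (metis fps_zero_nth zero_neq_one)
  ultimately have "W = V" by simp
  with W show ?thesis by (simp add: V_def c_def)
qed

section \<open>Coefficients along the flow and their time derivative\<close>

definition weinstein_fps :: "nat \<Rightarrow> complex fps" where
  "weinstein_fps k = koebe_inv_fps ^ (k+1) * inverse (1 - koebe_inv_fps\<^sup>2)"

text \<open>As \<open>K(z) = e\<^sup>t \<sqdot> e\<^sup>-\<^sup>t K(z)\<close>, the function \<open>K w\<^sup>k\<close> is \<open>e\<^sup>t\<close> times
  \<open>X J\<^sup>k\<close> with \<open>e\<^sup>-\<^sup>t K\<close> substituted for \<open>X\<close>.\<close>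

definition de_branges_fps :: "nat \<Rightarrow> complex fps" where
  "de_branges_fps k = fps_X * koebe_inv_fps ^ k"

text \<open>The common form of the Weinstein functions and of the explicit candidates for
  \<open>\<tau>\<close>; \<open>Re\<close> makes it real-valued, as \<open>dot\<close>
  requires.\<close>

definition koebe_flow_coeff :: "complex fps \<Rightarrow> nat \<Rightarrow> real \<Rightarrow> real" where
  "koebe_flow_coeff F n t =
     Re (of_real (exp t) * fps_nth (F oo (fps_const (of_real (exp (-t))) * koebe_fps)) n)"

lemma koebe_flow_coeff_diff:
  "koebe_flow_coeff (F - G) n t = koebe_flow_coeff F n t - koebe_flow_coeff G n t"
  by (simp add: koebe_flow_coeff_def fps_compose_sub_distrib algebra_simps)

lemma koebe_flow_coeff_add:
  "koebe_flow_coeff (F + G) n t = koebe_flow_coeff F n t + koebe_flow_coeff G n t"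
  by (simp add: koebe_flow_coeff_def fps_compose_add_distrib algebra_simps)

lemma koebe_flow_coeff_eq_sum:
  "koebe_flow_coeff F n t =
     (\<Sum>i=0..n. Re (fps_nth F i * fps_nth (koebe_fps ^ i) n) * (exp t * exp (-t) ^ i))"
proof -
  have "of_real (exp t) * fps_nth (F oo (fps_const (of_real (exp (-t))) * koebe_fps)) n =
     (\<Sum>i=0..n. fps_nth F i * fps_nth (koebe_fps ^ i) n * of_real (exp t * exp (-t) ^ i))"
    by (simp add: fps_compose_nth power_mult_distrib sum_distrib_left
        mult_ac)
  moreover have "Re (z * of_real r) = Re z * r" for z r by simp
  ultimately show ?thesis
    unfolding koebe_flow_coeff_def by (simp only: Re_sum)
qed

text \<open>The term X^i contributes a multiple of exp((1 - i) t), so d/dt multiplies the i-th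
  coefficient of F by 1 - i.\<close>

lemma koebe_flow_coeff_has_derivative:
  "(koebe_flow_coeff F n has_real_derivative koebe_flow_coeff (F - fps_X * fps_deriv F) n t)
     (at t within S)"
proof -
  have nth: "fps_nth (F - fps_X * fps_deriv F) i = of_real (1 - real i) * fps_nth F i" for i
    by (cases i) (auto simp: algebra_simps)
  have exp_eq: "exp t * exp (-t) ^ i = exp ((1 - real i) * t)" for i and t :: real
    by (simp add: algebra_simps flip: exp_of_nat_mult exp_add)
  have "((\<lambda>t. exp t * exp (-t) ^ i) has_real_derivative
      (1 - real i) * (exp t * exp (-t) ^ i)) (at t within S)" for i
    unfolding exp_eq by (auto intro!: derivative_eq_intros)
  then have "((\<lambda>t. \<Sum>i=0..n. Re (fps_nth F i * fps_nth (koebe_fps ^ i) n) * (exp t * exp (-t) ^ i))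
      has_real_derivative
      (\<Sum>i=0..n. Re (fps_nth F i * fps_nth (koebe_fps ^ i) n) *
         ((1 - real i) * (exp t * exp (-t) ^ i)))) (at t within S)"
    by (intro DERIV_sum DERIV_cmult)
  moreover have "(\<Sum>i=0..n. Re (fps_nth F i * fps_nth (koebe_fps ^ i) n) *
         ((1 - real i) * (exp t * exp (-t) ^ i))) = koebe_flow_coeff (F - fps_X * fps_deriv F) n t"
    unfolding koebe_flow_coeff_eq_sum nth
    by (intro sum.cong refl) (simp add: algebra_simps)
  ultimately show ?thesis
    unfolding koebe_flow_coeff_eq_sum[abs_def] by simp
qed

section \<open>Algebraic identities between the two families\<close>

lemma weinstein_fps_cancel:
  "weinstein_fps k * (1 - koebe_inv_fps\<^sup>2) = koebe_inv_fps ^ (k+1)"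
  by (simp add: weinstein_fps_def mult.assoc inverse_mult_eq_1 power2_eq_square)

lemma one_minus_koebe_inv_fps_sq_neq_0: "1 - koebe_inv_fps\<^sup>2 \<noteq> 0"
proof
  assume "1 - koebe_inv_fps\<^sup>2 = 0"
  from arg_cong[OF this, of "\<lambda>F. fps_nth F 0"] show False by (simp add: power2_eq_square)
qed

text \<open>The left side is -k X^2 J^(k-1) J'. After multiplication by 1 - J^2, the equation for X
  J' (1 + J) removes the derivative and X (1 - J)^2 = J removes X.\<close>

lemma de_branges_fps_euler:
  "de_branges_fps k - fps_X * fps_deriv (de_branges_fps k) = - of_nat k * weinstein_fps k"
proof (cases k)
  case 0
  then show ?thesis by (simp add: de_branges_fps_def)
next
  case (Suc m)
  let ?J = "koebe_inv_fps"
  have deriv: "de_branges_fps k - fps_X * fps_deriv (de_branges_fps k)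
      = - of_nat k * (fps_X * ?J ^ m * (fps_X * fps_deriv ?J))"
    by (simp add: de_branges_fps_def Suc fps_deriv_power' algebra_simps del: power_Suc)
  have "fps_X * ?J ^ m * (fps_X * fps_deriv ?J) * (1 - ?J\<^sup>2) = ?J ^ m * ?J * ?J"
  proof -
    have "fps_X * ?J ^ m * (fps_X * fps_deriv ?J) * (1 - ?J\<^sup>2)
        = ?J ^ m * fps_X * (1 - ?J) * (fps_X * fps_deriv ?J * (1 + ?J))"
      by (simp add: algebra_simps power2_eq_square)
    also have "\<dots> = ?J ^ m * ?J * (fps_X * (1 - ?J)\<^sup>2)"
      unfolding koebe_inv_fps_deriv by (simp add: power2_eq_square mult_ac)
    finally show ?thesis by (simp only: koebe_inv_fps_eq)
  qed
  also have "\<dots> = weinstein_fps k * (1 - ?J\<^sup>2)"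
    by (simp add: weinstein_fps_cancel Suc)
  finally have "fps_X * ?J ^ m * (fps_X * fps_deriv ?J) = weinstein_fps k"
    using one_minus_koebe_inv_fps_sq_neq_0 by simp
  with deriv show ?thesis by simp
qed

text \<open>Multiplied by 1 - J^2, both sides become J^(k+1) (1 + J), again by X (1 - J)^2 = J. With
  the Euler identity this is the de Branges recursion.\<close>

lemma de_branges_fps_diff:
  "de_branges_fps k - de_branges_fps (k+1) = weinstein_fps k + weinstein_fps (k+1)"
proof -
  let ?J = "koebe_inv_fps"
  have "(weinstein_fps k + weinstein_fps (k+1)) * (1 - ?J\<^sup>2) = ?J ^ k * ?J * (1 + ?J)"
    by (simp add: distrib_right weinstein_fps_cancel) (simp add: algebra_simps)
  also have "\<dots> = (fps_X * ?J ^ k - fps_X * (?J * ?J ^ k)) * (1 - ?J\<^sup>2)"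
  proof -
    have "(fps_X * ?J ^ k - fps_X * (?J * ?J ^ k)) * (1 - ?J\<^sup>2)
        = ?J ^ k * (fps_X * (1 - ?J)\<^sup>2) * (1 + ?J)"
      by (simp add: algebra_simps power2_eq_square)
    then show ?thesis by (simp only: koebe_inv_fps_eq)
  qed
  finally show ?thesis
    using one_minus_koebe_inv_fps_sq_neq_0 by (simp add: de_branges_fps_def)
qed

text \<open>Substitution commutes with products and inverses, so it can be pulled out of the whole
  quotient.\<close>

lemma weinstein_eq_koebe_flow_coeff:
  assumes t: "t \<ge> 0"
  shows "weinstein k n t = koebe_flow_coeff (weinstein_fps k) (n+1) t"
proof -
  define C where "C = fps_const (of_real (exp (-t))) * koebe_fps"
  have C0: "fps_nth C 0 = 0" by (simp add: C_def)
  define W where "W = koebe_inv_fps oo C"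
  have W0: "fps_nth W 0 = 0" by (simp add: W_def)
  have W: "(\<lambda>z. koebe_flow z t) has_fps_expansion W"
    unfolding W_def C_def by (rule koebe_flow_fps_expansion[OF t])
  have "(\<lambda>z. of_real (exp t) * koebe_flow z t ^ (k+1) * inverse (1 - (koebe_flow z t)\<^sup>2))
      has_fps_expansion fps_const (of_real (exp t)) * W ^ (k+1) * inverse (1 - W\<^sup>2)"
    by (intro fps_expansion_intros W) (simp add: W0 power2_eq_square)
  also have "fps_const (of_real (exp t)) * W ^ (k+1) * inverse (1 - W\<^sup>2)
      = fps_const (of_real (exp t)) * (weinstein_fps k oo C)"
    unfolding weinstein_fps_def W_def using C0
    by (simp add: fps_compose_mult_distrib fps_compose_power[symmetric] fps_inverse_compose
        fps_compose_sub_distrib power2_eq_square mult.assoc)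
  finally have "weinstein_gen k t has_fps_expansion
      fps_const (of_real (exp t)) * (weinstein_fps k oo C)"
    unfolding weinstein_gen_def divide_inverse .
  from fps_nth_fps_expansion[OF this, of "n+1"] show ?thesis
    by (simp add: weinstein_def koebe_flow_coeff_def C_def)
qed

lemma koebe_flow_coeff_de_branges_deriv:
  "(koebe_flow_coeff (de_branges_fps k) n has_real_derivative
     - real k * koebe_flow_coeff (weinstein_fps k) n t) (at t within S)"
proof -
  have "koebe_flow_coeff (- of_nat k * weinstein_fps k) n t
      = - real k * koebe_flow_coeff (weinstein_fps k) n t"
    by (simp add: koebe_flow_coeff_eq_sum sum_distrib_left sum_negf[symmetric] algebra_simps
        flip: fps_of_nat)
  with koebe_flow_coeff_has_derivative[of "de_branges_fps k" n t S] show ?thesis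
    by (simp only: de_branges_fps_euler)
qed

section \<open>Boundary values and uniqueness\<close>

lemma koebe_flow_coeff_de_branges_0:
  assumes "k \<le> n + 1"
  shows "koebe_flow_coeff (de_branges_fps k) (n+1) 0 = real n + 1 - real k"
proof -
  have "koebe_inv_fps oo koebe_fps = fps_X"
    unfolding koebe_inv_fps_def by (rule fps_inv) auto
  then have "de_branges_fps k oo koebe_fps = koebe_fps * fps_X ^ k"
    by (simp add: de_branges_fps_def fps_compose_mult_distrib fps_compose_power[symmetric])
  with assms show ?thesis
    by (simp add: koebe_flow_coeff_def fps_X_power_mult_right_nth)
qed

text \<open>The series X J^(n+1) starts only at X^(n+2), one index too late to contribute.\<close>

lemma koebe_flow_coeff_de_branges_eq_0:
  "koebe_flow_coeff (de_branges_fps (Suc n)) (Suc n) t = 0"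
proof -
  have "fps_nth (de_branges_fps (Suc n)) i = 0" if "i \<le> Suc n" for i
    using that startsby_zero_power_prefix[OF koebe_inv_fps_nth_0, of "Suc n"]
    by (auto simp: de_branges_fps_def simp del: power_Suc)
  then show ?thesis by (simp add: koebe_flow_coeff_eq_sum)
qed

text \<open>With the integrating factor exp(a s), the product is constant.\<close>

lemma linear_ode_unique_0:
  fixes f :: "real \<Rightarrow> real"
  assumes f: "\<And>s. s \<ge> 0 \<Longrightarrow> (f has_real_derivative - a * f s) (at s within {0..})"
    and "f 0 = 0" "t \<ge> 0"
  shows "f t = 0"
proof -
  have "((\<lambda>s. f s * exp (a * s)) has_real_derivative 0) (at s within {0..})" if "s \<ge> 0" for s
    by (auto intro!: derivative_eq_intros f[OF that])
  then obtain c where c: "\<And>s. s \<in> {0..} \<Longrightarrow> f s * exp (a * s) = c"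
    using has_field_derivative_zero_constant[of "{0..}" "\<lambda>s. f s * exp (a * s)"] by auto
  from c[of 0] c[of t] \<open>f 0 = 0\<close> \<open>t \<ge> 0\<close> show ?thesis by simp
qed

lemma de_branges_functions_has_derivative:
  assumes "de_branges_functions n \<tau>" "k \<in> {1..n+1}" "t \<ge> 0"
  shows "(\<tau> k has_real_derivative dot (\<tau> k) t) (at t within {0..})"
proof -
  have "\<tau> k differentiable_on {0..}"
    using assms by (simp add: de_branges_functions_def)
  with \<open>t \<ge> 0\<close> obtain d where "(\<tau> k has_real_derivative d) (at t within {0..})"
    unfolding differentiable_on_def real_differentiable_def by auto
  with dot_eqI[OF \<open>t \<ge> 0\<close> this] show ?thesis by simp
qed

text \<open>Downward induction from k = n + 1, where both sides vanish: once level k + 1 agrees, the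
  recursion is a scalar linear equation at level k.\<close>

lemma de_branges_functions_eq:
  assumes \<tau>: "de_branges_functions n \<tau>" and k: "k \<in> {1..n+1}" and t: "t \<ge> 0"
  shows "\<tau> k t = koebe_flow_coeff (de_branges_fps k) (n+1) t"
proof -
  let ?\<sigma> = "\<lambda>k. koebe_flow_coeff (de_branges_fps k) (n+1)"
  let ?\<Lambda> = "\<lambda>k. koebe_flow_coeff (weinstein_fps k) (n+1)"
  have "\<forall>t\<ge>0. \<tau> k t = ?\<sigma> k t"
    if "k \<le> n + 1" "1 \<le> k" for k
    using that
  proof (induction rule: inc_induct)
    case base
    then show ?case using \<tau> by (simp add: de_branges_functions_def koebe_flow_coeff_de_branges_eq_0)
  next
    case (step k)
    then have IH: "\<And>t. t \<ge> 0 \<Longrightarrow> \<tau> (k+1) t = ?\<sigma> (k+1) t" and k: "1 \<le> k" "k \<le> n" by auto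
    have dk: "((\<lambda>t. \<tau> k t - ?\<sigma> k t) has_real_derivative - real k * (\<tau> k s - ?\<sigma> k s))
        (at s within {0..})" if s: "s \<ge> 0" for s
    proof -
      have "(\<tau> (k+1) has_real_derivative - real (k+1) * ?\<Lambda> (k+1) s) (at s within {0..})"
        by (rule has_field_derivative_transform_within[OF
              koebe_flow_coeff_de_branges_deriv zero_less_one])
          (use s IH in auto)
      from dot_eqI[OF s this] have "dot (\<tau> (k+1)) s / real (k+1) = - ?\<Lambda> (k+1) s"
        by (simp add: field_simps)
      moreover have "\<tau> (k+1) s - \<tau> k s = dot (\<tau> k) s / real k + dot (\<tau> (k+1)) s / real (k+1)"
        using \<tau> k s by (simp add: de_branges_functions_def)
      moreover have "?\<sigma> k s - ?\<sigma> (k+1) s = ?\<Lambda> k s + ?\<Lambda> (k+1) s"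
        by (simp only: de_branges_fps_diff flip: koebe_flow_coeff_diff koebe_flow_coeff_add)
      ultimately have "dot (\<tau> k) s / real k = ?\<sigma> k s - \<tau> k s - ?\<Lambda> k s"
        using IH[OF s] by simp
      \<comment> \<open>Level k + 1 has cancelled, so the difference d of the two solutions
        satisfies d' = -k d.\<close>
      then have dot: "dot (\<tau> k) s - - real k * ?\<Lambda> k s = - real k * (\<tau> k s - ?\<sigma> k s)"
        using k by (simp add: field_simps)
      show ?thesis
        unfolding dot[symmetric] using k
        by (intro DERIV_diff koebe_flow_coeff_de_branges_deriv
            de_branges_functions_has_derivative[OF \<tau> _ s]) auto
    qed
    have "\<tau> k 0 - ?\<sigma> k 0 = 0"
      using \<tau> k koebe_flow_coeff_de_branges_0[of k n] by (simp add: de_branges_functions_def)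
    then have "\<tau> k t - ?\<sigma> k t = 0" if "t \<ge> 0" for t
      using linear_ode_unique_0[OF dk _ that] by simp
    then show ?case by simp
  qed
  with k t show ?thesis by simp
qed

theorem theorem2:
  fixes \<tau> :: "nat \<Rightarrow> real \<Rightarrow> real" and n k :: nat and t :: real
  assumes "n \<ge> 1"
    and "de_branges_functions n \<tau>"
    and "k \<in> {1..n}"
    and "t \<ge> 0"
  shows "dot (\<tau> k) t = - real k * weinstein k n t \<and>
         (dot (\<tau> k) t \<le> 0 \<longleftrightarrow> weinstein k n t \<ge> 0)"
proof -
  have "k \<in> {1..n+1}" using assms(3) by simp
  note eq = de_branges_functions_eq[OF assms(2) this]
  \<comment> \<open>Agreement on all of [0, \<infinity>) transfers the derivative, including the
    one-sided one at 0; the radius 1 is arbitrary.\<close>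
  have "(\<tau> k has_real_derivative - real k * koebe_flow_coeff (weinstein_fps k) (n+1) t)
      (at t within {0..})"
    by (rule has_field_derivative_transform_within[OF
          koebe_flow_coeff_de_branges_deriv zero_less_one])
      (use assms(4) eq in auto)
  from dot_eqI[OF assms(4) this] have "dot (\<tau> k) t = - real k * weinstein k n t"
    by (simp add: weinstein_eq_koebe_flow_coeff[OF assms(4)])
  then show ?thesis using assms(3) by (simp add: zero_le_mult_iff)
qed

end
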